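(* Let $\mathcal{N}=\{1,\dots,n\}$ be a universe of products, let $T\ge1$ be the number of customers, and suppose that all products have identical preference weights, i.e. $v_1=\cdots=v_n=v$ for some $v>0$. Then there exists a static weight-ordered assortment that provides a $1/2$-approximation to the dynamic maximum load assortment problem, i.e. $$\mathrm{OPT}^{\mathrm{WO}}(\mathcal{N})\ \ge\ \frac12\cdot\mathrm{OPT}^{\mathrm{DP}}(\mathcal{N}).$$
   Context: Multinomial Logit (MNL) model: each product $i\in\mathcal{N}$ has preference weight $v_i>0$ and the no-purchase option $0$ has weight $1$. For an assortment $S\subseteq\mathcal{N}$ let $v(S)=\sum_{i\in S}v_i$, $\phi_i(S)=\frac{v_i}{1+v(S)}$ for $i\in S$, and $\phi_0(S)=\frac{1}{1+v(S)}$. Static setting: when $S$ is offered to all $T$ customers, each customer independently chooses option $i\in S\cup\{0\}$ with probability $\phi_i(S)$; $L_i(S)$ is the number of customers choosing product $i$ and $M(S)=\max_{i\in S}L_i(S)$. With products indexed in non-increasing order of weight, define $\mathrm{OPT}^{\mathrm{WO}}(\mathcal{N})=\max_{1\le m\le n}\mathbb{E}(M(\{1,\dots,m\}))$, the best expected maximum load of a static weight-ordered assortment, i.e. one of the form $\{1,\dots,m\}$. Dynamic setting: customers arrive one by one, and the assortment offered to each customer may depend on the current load vector $\boldsymbol\ell\in\mathbb{Z}_{\ge0}^n$ (the number of previous customers who chose each product) and on the number of remaining customers; a customer offered $S$ chooses $i\in S\cup\{0\}$ with probability $\phi_i(S)$. Let $\mathcal{M}_0(\boldsymbol\ell)=\max_i\ell_i$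 and $$\mathcal{M}_t(\boldsymbol\ell)=\max_{S\subseteq\mathcal{N}}\Big(\mathcal{M}_{t-1}(\boldsymbol\ell)\,\phi_0(S)+\sum_{i\in S}\mathcal{M}_{t-1}(\boldsymbol\ell+\mathbf{e}_i)\,\phi_i(S)\Big),$$ where $\mathbf{e}_i$ is the $i$-th unit vector. Then $\mathrm{OPT}^{\mathrm{DP}}(\mathcal{N})=\mathcal{M}_T(\mathbf{0})$ is the optimal expected maximum load of an adaptive policy. *)

theory Defs
  imports "HOL-Probability.Probability" "HOL-Probability.Product_PMF"
begin

text \<open>
  The universe of products is \<open>{1..n}\<close>, and \<open>0\<close> is the no-purchase option. Hence an assortment is a
  finite set of naturals not containing \<open>0\<close>, and only the weights \<open>v i\<close> with \<open>i \<in> {1..n}\<close> matter.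
\<close>

definition total_weight :: "(nat \<Rightarrow> real) \<Rightarrow> nat set \<Rightarrow> real" where
  "total_weight v S = (\<Sum>i\<in>S. v i)"

definition choice_prob :: "(nat \<Rightarrow> real) \<Rightarrow> nat set \<Rightarrow> nat \<Rightarrow> real" where
  "choice_prob v S i =
     (if i = 0 then 1 / (1 + total_weight v S)
      else if i \<in> S then v i / (1 + total_weight v S)
      else 0)"

definition mnl_choice :: "(nat \<Rightarrow> real) \<Rightarrow> nat set \<Rightarrow> nat pmf" where
  "mnl_choice v S = embed_pmf (choice_prob v S)"

text \<open>
  \<open>embed_pmf\<close> is meaningful only for nonnegative functions of total mass one; the next lemma confirms
  this for every assortment.
\<close>

lemma pmf_mnl_choice:
  assumes "finite S" "0 \<notin> S" "\<And>i. i \<in> S \<Longrightarrow> v i > 0"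
  shows "pmf (mnl_choice v S) i = choice_prob v S i"
proof -
  have tw: "total_weight v S \<ge> 0"
    unfolding total_weight_def using assms(3) by (intro sum_nonneg) (simp add: less_imp_le)
  have nonneg: "choice_prob v S j \<ge> 0" for j
    using tw assms(3) by (auto simp: choice_prob_def less_imp_le)
  have "(\<Sum>j\<in>S. choice_prob v S j) = (\<Sum>j\<in>S. v j / (1 + total_weight v S))"
    using assms(2) by (intro sum.cong) (auto simp: choice_prob_def)
  also have "\<dots> = total_weight v S / (1 + total_weight v S)"
    by (simp add: total_weight_def sum_divide_distrib)
  finally have sum1: "(\<Sum>j\<in>insert 0 S. choice_prob v S j) = 1"
    using assms(1,2) tw by (simp add: choice_prob_def add_divide_distrib[symmetric])
  have "(\<integral>\<^sup>+ j. ennreal (choice_prob v S j) \<partial>count_space UNIV)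
      = (\<Sum>j\<in>insert 0 S. ennreal (choice_prob v S j))"
    using assms(1) by (intro nn_integral_count_space') (auto simp: choice_prob_def)
  also have "\<dots> = ennreal (\<Sum>j\<in>insert 0 S. choice_prob v S j)"
    using nonneg by (simp add: sum_ennreal del: sum.insert)
  also have "\<dots> = 1"
    by (simp only: sum1 ennreal_1)
  finally show ?thesis
    unfolding mnl_choice_def by (intro pmf_embed_pmf nonneg)
qed

text \<open>
  An outcome of the static setting is a function \<open>c\<close> giving the option \<open>c t\<close> chosen by each of the
  independent customers \<open>t < T\<close>; the \<open>0\<close> below is only the dummy value for indices \<open>t \<ge> T\<close>.
\<close>

definition static_choices :: "(nat \<Rightarrow> real) \<Rightarrow> nat \<Rightarrow> nat set \<Rightarrow> (nat \<Rightarrow> nat) pmf" where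
  "static_choices v T S = Pi_pmf {..<T} 0 (\<lambda>_. mnl_choice v S)"

definition load :: "nat \<Rightarrow> (nat \<Rightarrow> nat) \<Rightarrow> nat \<Rightarrow> nat" where
  "load T c i = card {t \<in> {..<T}. c t = i}"

definition max_load :: "nat \<Rightarrow> nat set \<Rightarrow> (nat \<Rightarrow> nat) \<Rightarrow> nat" where
  "max_load T S c = Max (load T c ` S)"

definition expected_max_load :: "(nat \<Rightarrow> real) \<Rightarrow> nat \<Rightarrow> nat set \<Rightarrow> real" where
  "expected_max_load v T S =
     measure_pmf.expectation (static_choices v T S) (\<lambda>c. real (max_load T S c))"

text \<open>
  \<open>OPT_WO\<close> is the weight-ordered optimum when \<open>n \<ge> 1\<close> and \<open>v\<close> is non-increasing on \<open>{1..n}\<close>.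
\<close>

definition OPT_WO :: "(nat \<Rightarrow> real) \<Rightarrow> nat \<Rightarrow> nat \<Rightarrow> real" where
  "OPT_WO v T n = Max ((\<lambda>m. expected_max_load v T {1..m}) ` {1..n})"

text \<open>
  In \<open>dp_value v n t l\<close>, \<open>t\<close> is the number of remaining customers and \<open>l\<close> the current load vector,
  of which only the entries in \<open>{1..n}\<close> are used.
\<close>

primrec dp_value :: "(nat \<Rightarrow> real) \<Rightarrow> nat \<Rightarrow> nat \<Rightarrow> (nat \<Rightarrow> nat) \<Rightarrow> real" where
  "dp_value v n 0 l = real (Max (l ` {1..n}))"
| "dp_value v n (Suc t) l =
     Max ((\<lambda>S. dp_value v n t l * choice_prob v S 0
               + (\<Sum>i\<in>S. dp_value v n t (l(i := l i + 1)) * choice_prob v S i))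
          ` Pow {1..n})"

definition OPT_DP :: "(nat \<Rightarrow> real) \<Rightarrow> nat \<Rightarrow> nat \<Rightarrow> real" where
  "OPT_DP v T n = dp_value v n T (\<lambda>_. 0)"

end

theory Submission
  imports Defs
begin

text \<open>
  With all weights equal to \<open>w\<close>, an assortment of size \<open>m\<close> sells each of its products with
  probability \<open>w / (1 + m w)\<close>. So the adaptive policy, whatever it does, sells each product with
  probability at most \<open>q = w / (1 + w)\<close> per customer, and sells at most one product per customer.
  The static assortment that competes with it is \<open>{1..k}\<close> for \<open>k = min n (\<lceil>1 / w\<rceil> + 1)\<close>. Two
  properties determine this \<open>k\<close>.

  First, \<open>k\<close> is so large that further products are useless to the adaptive policy. By
  symmetry and exchange (\<open>dp_value_transpose\<close>, \<open>dp_value_exchange\<close>), a sale of a product with a higher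
  load is worth at least as much as a sale of one with a lower load. If only products in \<open>{1..k}\<close>
  have been sold so far, it is therefore no loss to move the probability mass of an assortment onto
  \<open>{1..k}\<close>. This is possible with at most \<open>q\<close> on each product, because either \<open>k = n\<close> or
  \<open>k q \<ge> 1\<close> (\<open>rates_on_top_set\<close>, \<open>dp_value_Suc_le_rates\<close>). Starting from the empty load vector, the
  sales thus never leave \<open>{1..k}\<close>.

  Second, \<open>k\<close> is so small that \<open>{1..k}\<close> sells each of its products with probability
  \<open>r = w / (1 + k w) \<ge> q / 2\<close>. Keep each sale of the adaptive policy independently with probability
  \<open>1/2\<close>. In expectation this keeps half of the load of the most sold product, hence at least half of the
  maximum load. On the other hand, the sales that are kept occur with probability at most
  \<open>q / 2 \<le> r\<close> per product and customer, whatever happened before, so offering \<open>{1..k}\<close> to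
  everybody does at least as well. The lemma \<open>dp_value_le_thin\<close> carries out this comparison by
  induction on the number of remaining customers.

  The comparison is made after thinning because selling every product of \<open>{1..k}\<close> with
  probability \<open>q\<close> could take a total probability above one, whereas rate \<open>r\<close> on every product of
  \<open>{1..k}\<close> is realised by an assortment.
\<close>

abbreviation inc :: "nat \<Rightarrow> (nat \<Rightarrow> nat) \<Rightarrow> nat \<Rightarrow> nat" where
  "inc i l \<equiv> l(i := l i + 1)"

lemma inc_commute: "inc i (inc j l) = inc j (inc i l)"
  by (auto simp: fun_eq_iff)

lemma inc_count_list: "inc i (count_list xs) = count_list (i # xs)"
  by (auto simp: fun_eq_iff)

lemma Max_image_mono:
  fixes f g :: "'a \<Rightarrow> 'b :: linorder"
  assumes "finite A" "A \<noteq> {}" "\<And>a. a \<in> A \<Longrightarrow> f a \<le> g a"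
  shows "Max (f ` A) \<le> Max (g ` A)"
proof (intro Max.boundedI)
  fix y assume "y \<in> f ` A"
  then obtain a where "a \<in> A" "y = f a" by blast
  then have "y \<le> g a" using assms(3) by simp
  also have "\<dots> \<le> Max (g ` A)" using assms(1) \<open>a \<in> A\<close> by simp
  finally show "y \<le> Max (g ` A)" .
qed (use assms in auto)

section \<open>Thinned purchase sequences\<close>

text \<open>
  \<open>thin xs F\<close> is the expectation of \<open>F\<close> at the load vector that remains of the sequence of sales
  \<open>xs\<close> when each sale is kept with probability \<open>1/2\<close>. Recursion on the sequence of sales, rather
  than binomial thinning of a load vector, makes the effect of one more sale the defining equation.
\<close>

primrec thin :: "nat list \<Rightarrow> ((nat \<Rightarrow> nat) \<Rightarrow> real) \<Rightarrow> real" where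
  "thin [] F = F (\<lambda>_. 0)"
| "thin (x # xs) F = (thin xs F + thin xs (\<lambda>l. F (inc x l))) / 2"

lemma thin_mono:
  assumes "\<And>l. F l \<le> G l"
  shows "thin xs F \<le> thin xs G"
  using assms
proof (induction xs arbitrary: F G)
  case (Cons x xs)
  have "thin xs F \<le> thin xs G" "thin xs (\<lambda>l. F (inc x l)) \<le> thin xs (\<lambda>l. G (inc x l))"
    using Cons.prems by (auto intro!: Cons.IH)
  then show ?case by simp
qed simp

lemma thin_add: "thin xs (\<lambda>l. F l + G l) = thin xs F + thin xs G"
proof (induction xs arbitrary: F G)
  case (Cons x xs)
  show ?case by (simp only: thin.simps Cons.IH) argo
qed simp

lemma thin_cmult: "thin xs (\<lambda>l. c * F l) = c * thin xs F"
proof (induction xs arbitrary: F)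
  case (Cons x xs)
  show ?case by (simp only: thin.simps Cons.IH) (simp add: algebra_simps)
qed simp

lemma thin_sum:
  assumes "finite A"
  shows "thin xs (\<lambda>l. \<Sum>i\<in>A. F i l) = (\<Sum>i\<in>A. thin xs (F i))"
  using assms
proof (induction A rule: finite_induct)
  case empty
  show ?case using thin_cmult[of xs 0 "\<lambda>_. 0"] by simp
qed (simp add: thin_add)

lemma thin_coordinate:
  "thin xs (\<lambda>l. real (l i) + c) = real (count_list xs i) / 2 + c"
proof (induction xs arbitrary: c)
  case (Cons x xs)
  have "thin xs (\<lambda>l. real (inc x l i) + c) = real (count_list xs i) / 2 + ((if x = i then 1 else 0) + c)"
    by (subst Cons.IH[symmetric], rule arg_cong[of _ _ "thin xs"]) (auto simp: fun_eq_iff)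
  then show ?case using Cons.IH[of c] by (auto simp: field_simps)
qed simp

text \<open>
  Thinning at most halves the maximum load: the expected maximum is at least the expected load of a
  fixed product, in particular of the one that had the highest load before thinning.
\<close>

lemma count_le_thin_Max:
  assumes "finite K" "i \<in> K"
  shows "real (count_list xs i) \<le> 2 * thin xs (\<lambda>l. real (Max (l ` K)))"
proof -
  have "thin xs (\<lambda>l. real (l i) + 0) \<le> thin xs (\<lambda>l. real (Max (l ` K)))"
    using assms by (intro thin_mono) simp
  then show ?thesis by (simp only: thin_coordinate)
qed

section \<open>The static process as a recursion\<close>

text \<open>
  The expected maximum load over \<open>K\<close> after \<open>t\<close> further customers, each of whom buys each product of
  \<open>K\<close> with probability \<open>r\<close>, starting from the load vector \<open>l\<close>.
\<close>

primrec static_value :: "nat set \<Rightarrow> real \<Rightarrow> nat \<Rightarrow> (nat \<Rightarrow> nat) \<Rightarrow> real" where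
  "static_value K r 0 l = real (Max (l ` K))"
| "static_value K r (Suc t) l =
     (1 - real (card K) * r) * static_value K r t l + r * (\<Sum>i\<in>K. static_value K r t (inc i l))"

lemma static_value_mono:
  fixes r :: real
  assumes "finite K" "K \<noteq> {}" "0 \<le> r" "card K * r \<le> 1" "l \<le> l'"
  shows "static_value K r t l \<le> static_value K r t l'"
  using \<open>l \<le> l'\<close>
proof (induction t arbitrary: l l')
  case 0
  have "Max (l ` K) \<le> Max (l' ` K)"
    using assms(1,2) 0 by (intro Max_image_mono) (auto simp: le_fun_def)
  then show ?case by simp
next
  case (Suc t)
  have "static_value K r t (inc i l) \<le> static_value K r t (inc i l')" for i
    using Suc.prems by (intro Suc.IH) (auto simp: le_fun_def)
  then show ?case
    using assms Suc by (auto intro!: add_mono mult_left_mono sum_mono)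
qed

lemma load_Suc: "load (Suc t) (c(t := y)) i = load t c i + (if y = i then 1 else 0)"
proof -
  have "{s \<in> {..<Suc t}. (c(t := y)) s = i} =
        (if y = i then insert t {s \<in> {..<t}. c s = i} else {s \<in> {..<t}. c s = i})"
    by (auto simp: less_Suc_eq)
  then show ?thesis by (simp add: load_def)
qed

section \<open>Greedy choice of rates\<close>

text \<open>
  Here \<open>d i\<close> stands for the gain from a sale of product \<open>i\<close>, and \<open>K\<close> for a set of products whose
  gains are at least a threshold \<open>c\<close> that no other product exceeds. Measuring gains relative to
  \<open>c\<close> shows that products outside \<open>K\<close> contribute nothing beyond \<open>c\<close> each.
\<close>

lemma sum_le_threshold:
  fixes d :: "'a \<Rightarrow> real" and c :: real
  assumes "finite S" "finite K"
    and "\<And>j. j \<in> S - K \<Longrightarrow> d j \<le> c" and "\<And>i. i \<in> K \<Longrightarrow> c \<le> d i"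
    and "S \<inter> K \<subseteq> A" "A \<subseteq> K"
  shows "(\<Sum>i\<in>S. d i) \<le> card S * c + (\<Sum>i\<in>A. d i - c)"
proof -
  have "(\<Sum>i\<in>S. d i - c) = (\<Sum>i\<in>S \<inter> K. d i - c) + (\<Sum>i\<in>S - K. d i - c)"
    using assms(1) by (metis sum.Int_Diff)
  also have "(\<Sum>i\<in>S - K. d i - c) \<le> 0"
    using assms(3) by (intro sum_nonpos) auto
  also have "(\<Sum>i\<in>S \<inter> K. d i - c) \<le> (\<Sum>i\<in>A. d i - c)"
    using assms by (intro sum_mono2) (auto intro: finite_subset)
  finally show ?thesis by (simp add: sum_subtractf)
qed

text \<open>
  Probability mass spread over \<open>S\<close> can be moved onto the more profitable set \<open>K\<close>. If \<open>S\<close> is no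
  larger than \<open>K\<close>, the products of \<open>S - K\<close> are replaced by unused products of \<open>K\<close> at the same
  rate \<open>p\<close>. Otherwise the total mass \<open>card S * p \<le> 1\<close> is spread uniformly over \<open>K\<close>, which respects
  the cap \<open>q\<close> because \<open>K\<close> can absorb a total mass of one.
\<close>

lemma rates_on_top_set:
  fixes d :: "'a \<Rightarrow> real" and p q :: real
  assumes fin: "finite S" "finite K" and K: "K \<noteq> {}"
    and top: "\<forall>i\<in>K. \<forall>j\<in>S - K. d j \<le> d i"
    and p: "0 \<le> p" "p \<le> q" "card S * p \<le> 1"
    and room: "card S \<le> card K \<or> 1 \<le> card K * q"
  obtains x where "\<forall>i\<in>K. 0 \<le> x i \<and> x i \<le> q" "(\<Sum>i\<in>K. x i) \<le> 1"
    "p * (\<Sum>i\<in>S. d i) \<le> (\<Sum>i\<in>K. x i * d i)"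
proof -
  define c where "c = Min (d ` K)"
  have c_le: "c \<le> d i" if "i \<in> K" for i
    using that fin by (simp add: c_def)
  have c_ge: "d j \<le> c" if "j \<in> S - K" for j
    using top that fin K by (simp add: c_def)
  have cK: "card K > 0" using fin K by (simp add: card_gt_0_iff)
  show thesis
  proof (cases "card S \<le> card K")
    case True
    have "card (S \<inter> K) \<le> card S" using fin by (intro card_mono) auto
    then obtain A where A: "S \<inter> K \<subseteq> A" "A \<subseteq> K" "card A = card S"
      using exists_subset_between[of "S \<inter> K" "card S" K] True fin by auto
    define x where "x i = (if i \<in> A then p else 0)" for i
    have sum_x: "(\<Sum>i\<in>K. x i * f i) = p * (\<Sum>i\<in>A. f i)" for f
    proof -
      have "(\<Sum>i\<in>K. x i * f i) = (\<Sum>i\<in>A. p * f i)"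
        using fin A by (intro sum.mono_neutral_cong_right) (auto simp: x_def)
      then show ?thesis by (simp add: sum_distrib_left)
    qed
    show thesis
    proof (rule that[of x])
      show "\<forall>i\<in>K. 0 \<le> x i \<and> x i \<le> q" using p by (auto simp: x_def)
      show "(\<Sum>i\<in>K. x i) \<le> 1"
        using sum_x[of "\<lambda>_. 1"] A p by (simp add: mult.commute)
      have "(\<Sum>i\<in>S. d i) \<le> (\<Sum>i\<in>A. d i)"
        using sum_le_threshold[OF fin c_ge c_le A(1,2)] A(3) by (simp add: sum_subtractf)
      then show "p * (\<Sum>i\<in>S. d i) \<le> (\<Sum>i\<in>K. x i * d i)"
        using p by (simp add: sum_x mult_left_mono)
    qed
  next
    case False
    define x where "x = card S * p / card K"
    have xp: "p \<le> x" using False cK p by (simp add: x_def field_simps mult_left_mono)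
    have xK: "card K * x = card S * p" using cK by (simp add: x_def)
    show thesis
    proof (rule that[of "\<lambda>_. x"])
      have "x \<le> q"
        using False room p cK by (simp add: x_def divide_le_eq mult.commute)
      then show "\<forall>i\<in>K. 0 \<le> x \<and> x \<le> q" using p xp by simp
      show "(\<Sum>i\<in>K. x) \<le> 1" using xK p by simp
      have "p * (\<Sum>i\<in>S. d i) \<le> p * (card S * c + (\<Sum>i\<in>K. d i - c))"
        using sum_le_threshold[OF fin c_ge c_le, where A = K] p by (intro mult_left_mono) auto
      also have "\<dots> = card S * p * c + p * (\<Sum>i\<in>K. d i - c)"
        by (simp add: algebra_simps)
      also have "\<dots> = card K * x * c + p * (\<Sum>i\<in>K. d i - c)"
        by (simp only: xK)
      also have "p * (\<Sum>i\<in>K. d i - c) \<le> x * (\<Sum>i\<in>K. d i - c)"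
        using xp c_le by (intro mult_right_mono sum_nonneg) auto
      also have "card K * x * c + x * (\<Sum>i\<in>K. d i - c) = (\<Sum>i\<in>K. x * d i)"
        by (simp add: sum_subtractf sum_distrib_left[symmetric] algebra_simps)
      finally show "p * (\<Sum>i\<in>S. d i) \<le> (\<Sum>i\<in>K. x * d i)" by simp
    qed
  qed
qed

section \<open>Symmetry and exchange for equal weights\<close>

locale equal_weights =
  fixes n :: nat and v :: "nat \<Rightarrow> real" and w :: real
  assumes n_pos: "n \<ge> 1" and w_pos: "w > 0"
    and v_eq: "\<And>i. i \<in> {1..n} \<Longrightarrow> v i = w"
begin

definition rate :: "nat \<Rightarrow> real" where
  "rate m = w / (1 + m * w)"

lemma one_plus_pos: "1 + real m * w > 0"
  using w_pos by (simp add: add_pos_nonneg)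

lemma rate_nonneg: "0 \<le> rate m"
  using w_pos by (simp add: rate_def)

lemma rate_mass: "m * rate m \<le> 1"
  using one_plus_pos[of m] by (simp add: rate_def field_simps)

lemma rate_le_rate_1: "1 \<le> m \<Longrightarrow> rate m \<le> rate 1"
  using w_pos by (auto simp: rate_def intro!: divide_left_mono mult_pos_pos add_pos_nonneg)

lemma total_weight_eq: "S \<subseteq> {1..n} \<Longrightarrow> total_weight v S = card S * w"
  using v_eq by (simp add: total_weight_def subset_iff)

lemma choice_prob_none:
  assumes "S \<subseteq> {1..n}"
  shows "choice_prob v S 0 = 1 - card S * rate (card S)"
  using one_plus_pos[of "card S"] assms
  by (simp add: choice_prob_def total_weight_eq rate_def field_simps)

lemma choice_prob_member:
  assumes "S \<subseteq> {1..n}" "i \<in> S"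
  shows "choice_prob v S i = rate (card S)"
  using assms v_eq[of i] by (auto simp: choice_prob_def total_weight_eq rate_def)

lemma dp_value_Suc:
  "dp_value v n (Suc t) l =
    Max ((\<lambda>S. (1 - card S * rate (card S)) * dp_value v n t l
              + rate (card S) * (\<Sum>i\<in>S. dp_value v n t (inc i l))) ` Pow {1..n})"
  unfolding dp_value.simps
  by (intro arg_cong[of _ _ Max] image_cong refl)
     (auto simp: choice_prob_none choice_prob_member sum_distrib_left mult.commute intro!: sum.cong)

text \<open>
  Products of equal weight are interchangeable: offering \<open>S\<close> after relabelling has the effect of
  offering the relabelled \<open>S\<close> before.
\<close>

lemma dp_value_transpose:
  assumes ij: "i \<in> {1..n}" "j \<in> {1..n}"
  shows "dp_value v n t (l \<circ> Transposition.transpose i j) = dp_value v n t l"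
proof (induction t arbitrary: l)
  let ?\<tau> = "Transposition.transpose i j"
  have image: "?\<tau> ` {1..n} = {1..n}"
    using ij by (intro transpose_image_eq) auto
  {
    case 0
    have "(l \<circ> ?\<tau>) ` {1..n} = l ` {1..n}"
      by (simp only: image_comp[symmetric] image)
    then show ?case by simp
  next
    case (Suc t)
    let ?val = "\<lambda>l S. (1 - card S * rate (card S)) * dp_value v n t l
              + rate (card S) * (\<Sum>i\<in>S. dp_value v n t (inc i l))"
    have inc_transpose: "inc x (l \<circ> ?\<tau>) = inc (?\<tau> x) l \<circ> ?\<tau>" for x
      by (auto simp: fun_eq_iff transpose_eq_iff)
    have "?val (l \<circ> ?\<tau>) S = ?val l (?\<tau> ` S)" for S
    proof -
      have inj: "inj_on ?\<tau> S" by (metis inj_onI transpose_involutory)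
      have "dp_value v n t (inc x (l \<circ> ?\<tau>)) = dp_value v n t (inc (?\<tau> x) l)" for x
        by (simp only: inc_transpose Suc.IH)
      then show ?thesis
        by (simp only: Suc.IH card_image[OF inj] sum.reindex[OF inj]) (simp only: o_def)
    qed
    then have "?val (l \<circ> ?\<tau>) ` Pow {1..n} = ?val l ` image ?\<tau> ` Pow {1..n}"
      by (simp only: image_image)
    also have "image ?\<tau> ` Pow {1..n} = Pow {1..n}"
      by (simp only: image_Pow_surj[OF image])
    finally show ?case unfolding dp_value_Suc by (rule arg_cong)
  }
qed

text \<open>
  An extra unit is worth more on the product with the larger load. If the loads are equal, this is
  symmetry. If \<open>l j < l i\<close>, then \<open>l j \<le> l i\<close> still holds after any one sale, so whatever set is
  offered from \<open>inc j l\<close> may be offered from \<open>inc i l\<close> too, and the outcomes compare by induction.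
\<close>

lemma dp_value_exchange:
  assumes ij: "i \<in> {1..n}" "j \<in> {1..n}" and "l j \<le> l i"
  shows "dp_value v n t (inc j l) \<le> dp_value v n t (inc i l)"
  using \<open>l j \<le> l i\<close>
proof (induction t arbitrary: l)
  case 0
  have "Max (inc j l ` {1..n}) \<le> Max (inc i l ` {1..n})"
  proof (intro Max.boundedI)
    fix a assume "a \<in> inc j l ` {1..n}"
    then obtain x where x: "x \<in> {1..n}" "a = inc j l x" by blast
    have "a \<le> (if x = j then inc i l i else inc i l x)"
      using x 0 by auto
    also have "\<dots> \<le> Max (inc i l ` {1..n})"
      using x ij by (intro Max_ge) auto
    finally show "a \<le> Max (inc i l ` {1..n})" .
  qed (use n_pos in auto)
  then show ?case by simp
next
  case (Suc t)
  show ?case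
  proof (cases "l j = l i")
    case True
    have "inc j l = inc i l \<circ> Transposition.transpose i j"
    proof (rule ext)
      fix x
      show "inc j l x = (inc i l \<circ> Transposition.transpose i j) x"
        by (cases "x = i"; cases "x = j") (simp_all add: True Transposition.transpose_def)
    qed
    then have "dp_value v n (Suc t) (inc j l) = dp_value v n (Suc t) (inc i l)"
      by (simp only: dp_value_transpose[OF ij])
    then show ?thesis by (rule eq_refl)
  next
    case False
    let ?val = "\<lambda>l S. (1 - card S * rate (card S)) * dp_value v n t l
              + rate (card S) * (\<Sum>x\<in>S. dp_value v n t (inc x l))"
    have "?val (inc j l) S \<le> ?val (inc i l) S" for S
    proof (intro add_mono mult_left_mono sum_mono)
      show "dp_value v n t (inc j l) \<le> dp_value v n t (inc i l)"
        using Suc by blast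
      fix x
      \<comment> \<open>For \<open>x = j\<close> this needs the strict inequality.\<close>
      have "inc x l j \<le> inc x l i" using False Suc.prems by auto
      from Suc.IH[OF this] show "dp_value v n t (inc x (inc j l)) \<le> dp_value v n t (inc x (inc i l))"
        by (simp only: inc_commute[where i = x])
    qed (use rate_mass rate_nonneg in auto)
    then show ?thesis unfolding dp_value_Suc
      by (intro Max_image_mono) auto
  qed
qed

section \<open>Comparison of the adaptive and the static process\<close>

text \<open>
  As long as only products in \<open>{1..k}\<close> have positive load, every other product has the lowest
  possible load, so by exchange \<open>{1..k}\<close> is a set of most profitable products. The optimal first
  step is then dominated by a probability distribution on \<open>{1..k}\<close> that gives each product at
  most \<open>rate 1\<close>, the largest rate that any assortment achieves.
\<close>

lemma dp_value_Suc_le_rates: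
  assumes k: "1 \<le> k" "k \<le> n" "k = n \<or> 1 \<le> k * rate 1"
    and supp: "\<forall>j. j \<notin> {1..k} \<longrightarrow> l j = 0"
  obtains x where "\<forall>i\<in>{1..k}. 0 \<le> x i \<and> x i \<le> rate 1" "(\<Sum>i\<in>{1..k}. x i) \<le> 1"
    "dp_value v n (Suc t) l \<le> (1 - (\<Sum>i\<in>{1..k}. x i)) * dp_value v n t l
       + (\<Sum>i\<in>{1..k}. x i * dp_value v n t (inc i l))"
proof -
  let ?D = "dp_value v n t"
  let ?val = "\<lambda>S. (1 - card S * rate (card S)) * ?D l + rate (card S) * (\<Sum>i\<in>S. ?D (inc i l))"
  have "Max (?val ` Pow {1..n}) \<in> ?val ` Pow {1..n}"
    by (intro Max_in) auto
  then obtain S where S: "S \<subseteq> {1..n}" "dp_value v n (Suc t) l = ?val S"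
    unfolding dp_value_Suc by auto
  have fin: "finite S" using S(1) finite_subset by blast
  have top: "\<forall>i\<in>{1..k}. \<forall>j\<in>S - {1..k}. ?D (inc j l) - ?D l \<le> ?D (inc i l) - ?D l"
  proof (intro ballI diff_right_mono dp_value_exchange)
    fix i j assume "i \<in> {1..k}" "j \<in> S - {1..k}"
    then show "i \<in> {1..n}" "j \<in> {1..n}" "l j \<le> l i"
      using S(1) k(2) supp by auto
  qed
  \<comment> \<open>\<open>rate 0 = w\<close> exceeds \<open>rate 1\<close>, so the empty assortment is given rate 0.\<close>
  define p where "p = (if S = {} then 0 else rate (card S))"
  have p: "0 \<le> p" "card S * p \<le> 1"
    using rate_nonneg rate_mass by (auto simp: p_def)
  have pq: "p \<le> rate 1"
  proof (cases "S = {}")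
    case False
    then have "1 \<le> card S" using fin by (simp add: Suc_le_eq card_gt_0_iff)
    then show ?thesis using False rate_le_rate_1 by (simp add: p_def)
  qed (simp add: rate_nonneg p_def)
  have "card S \<le> n" using card_mono[OF _ S(1)] by simp
  then have room: "card S \<le> card {1..k} \<or> 1 \<le> card {1..k} * rate 1"
    using k(3) by auto
  have K: "finite {1..k}" "{1..k} \<noteq> {}" using k(1) by auto
  obtain x where x: "\<forall>i\<in>{1..k}. 0 \<le> x i \<and> x i \<le> rate 1" "(\<Sum>i\<in>{1..k}. x i) \<le> 1"
    "p * (\<Sum>i\<in>S. ?D (inc i l) - ?D l) \<le> (\<Sum>i\<in>{1..k}. x i * (?D (inc i l) - ?D l))"
    by (rule rates_on_top_set[OF fin K top p(1) pq p(2) room]) (rule that; assumption)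
  have "?val S = ?D l + p * (\<Sum>i\<in>S. ?D (inc i l) - ?D l)"
    by (simp add: p_def sum_subtractf algebra_simps)
  also have "\<dots> \<le> ?D l + (\<Sum>i\<in>{1..k}. x i * (?D (inc i l) - ?D l))"
    using x(3) by simp
  also have "\<dots> = (1 - (\<Sum>i\<in>{1..k}. x i)) * ?D l + (\<Sum>i\<in>{1..k}. x i * ?D (inc i l))"
    by (simp add: right_diff_distrib sum_subtractf flip: sum_distrib_right)
       (simp add: algebra_simps)
  finally show thesis using that[OF x(1,2)] S(2) by simp
qed

text \<open>
  The comparison with the static assortment. In the induction step, the next sale of product \<open>i\<close>
  occurs with probability \<open>x i \<le> rate 1\<close> and survives thinning with probability
  \<open>x i / 2 \<le> rate k\<close>. Since \<open>static_value\<close> is monotone in the loads, raising these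
  probabilities to \<open>rate k\<close> can only help, and the result is one step of the static process.
\<close>

lemma dp_value_le_thin:
  assumes k: "1 \<le> k" "k \<le> n" "k = n \<or> 1 \<le> k * rate 1" "rate 1 \<le> 2 * rate k"
    and xs: "set xs \<subseteq> {1..k}"
  shows "dp_value v n t (count_list xs) \<le> 2 * thin xs (static_value {1..k} (rate k) t)"
  using xs
proof (induction t arbitrary: xs)
  case 0
  have "Max (count_list xs ` {1..n}) \<in> count_list xs ` {1..n}"
    using n_pos by (intro Max_in) auto
  then obtain i where i: "Max (count_list xs ` {1..n}) = count_list xs i" by blast
  show ?case
  proof (cases "i \<in> {1..k}")
    case True
    then show ?thesis using count_le_thin_Max[of "{1..k}" i xs] i by simp
  next
    case False
    then have "count_list xs i = 0" using 0 by (auto simp: count_list_0_iff)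
    then show ?thesis using count_le_thin_Max[of "{1..k}" 1 xs] k(1) i by simp
  qed
next
  case (Suc t)
  let ?K = "{1..k}"
  let ?D = "dp_value v n t"
  let ?g = "static_value ?K (rate k) t"
  have supp: "\<forall>j. j \<notin> ?K \<longrightarrow> count_list xs j = 0"
    using Suc.prems by (auto simp: count_list_0_iff)
  obtain x where x: "\<forall>i\<in>?K. 0 \<le> x i \<and> x i \<le> rate 1" "(\<Sum>i\<in>?K. x i) \<le> 1"
    "dp_value v n (Suc t) (count_list xs) \<le> (1 - (\<Sum>i\<in>?K. x i)) * ?D (count_list xs)
       + (\<Sum>i\<in>?K. x i * ?D (inc i (count_list xs)))"
    by (rule dp_value_Suc_le_rates[OF k(1-3) supp]) (rule that; assumption)
  note x(3)
  also have "(1 - (\<Sum>i\<in>?K. x i)) * ?D (count_list xs) + (\<Sum>i\<in>?K. x i * ?D (inc i (count_list xs)))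
      \<le> (1 - (\<Sum>i\<in>?K. x i)) * (2 * thin xs ?g) + (\<Sum>i\<in>?K. x i * (2 * thin (i # xs) ?g))"
    unfolding inc_count_list using x(1,2) Suc.prems
    by (intro add_mono mult_left_mono sum_mono Suc.IH) auto
  also have "\<dots> = 2 * (thin xs ?g + (\<Sum>i\<in>?K. x i / 2 * (thin xs (\<lambda>l. ?g (inc i l)) + (-1) * thin xs ?g)))"
  proof -
    let ?H = "\<lambda>i. thin xs (\<lambda>l. ?g (inc i l))"
    have "(\<Sum>i\<in>?K. x i * (2 * thin (i # xs) ?g)) = (\<Sum>i\<in>?K. x i * thin xs ?g + x i * ?H i)"
      by (intro sum.cong refl) (simp only: thin.simps, argo)
    moreover have "\<dots> = (\<Sum>i\<in>?K. x i) * thin xs ?g + (\<Sum>i\<in>?K. x i * ?H i)"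
      by (simp only: sum.distrib sum_distrib_right)
    moreover have "(\<Sum>i\<in>?K. x i / 2 * (?H i + (-1) * thin xs ?g)) =
        (\<Sum>i\<in>?K. x i * ?H i / 2 - x i * thin xs ?g / 2)"
      by (intro sum.cong refl) argo
    moreover have "\<dots> = (\<Sum>i\<in>?K. x i * ?H i) / 2 - (\<Sum>i\<in>?K. x i) * thin xs ?g / 2"
      by (simp only: sum_subtractf sum_divide_distrib sum_distrib_right)
    ultimately show ?thesis by argo
  qed
  also have "\<dots> = 2 * thin xs (\<lambda>l. ?g l + (\<Sum>i\<in>?K. x i / 2 * (?g (inc i l) + (-1) * ?g l)))"
    by (simp only: thin_add thin_cmult thin_sum finite_atLeastAtMost)
  also have "\<dots> \<le> 2 * thin xs (static_value ?K (rate k) (Suc t))"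
  proof (intro mult_left_mono thin_mono)
    fix l
    have "(\<Sum>i\<in>?K. x i / 2 * (?g (inc i l) + (-1) * ?g l))
        \<le> (\<Sum>i\<in>?K. rate k * (?g (inc i l) + (-1) * ?g l))"
    proof (intro sum_mono mult_right_mono)
      fix i assume "i \<in> ?K"
      then have "x i \<le> rate 1" using x(1) by blast
      then show "x i / 2 \<le> rate k" using k(4) by linarith
      have "?g l \<le> ?g (inc i l)"
        using k(1) rate_nonneg rate_mass[of k]
        by (intro static_value_mono) (auto simp: le_fun_def)
      then show "0 \<le> ?g (inc i l) + (-1) * ?g l" by simp
    qed
    also have "\<dots> = static_value ?K (rate k) (Suc t) l - ?g l"
      by (simp add: sum_subtractf sum_distrib_left algebra_simps)
    finally show "?g l + (\<Sum>i\<in>?K. x i / 2 * (?g (inc i l) + (-1) * ?g l))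
        \<le> static_value ?K (rate k) (Suc t) l"
      by simp
  qed simp
  finally show ?case .
qed

section \<open>The expected maximum load of a static assortment\<close>

lemma expectation_mnl_choice:
  assumes "S \<subseteq> {1..n}"
  shows "measure_pmf.expectation (mnl_choice v S) f =
    (1 - card S * rate (card S)) * f 0 + rate (card S) * (\<Sum>i\<in>S. f i)" (is "_ = ?rhs")
    and "set_pmf (mnl_choice v S) \<subseteq> insert 0 S"
proof -
  have fin: "finite S" and S0: "0 \<notin> S" using assms finite_subset by auto
  have pmf: "pmf (mnl_choice v S) i = choice_prob v S i" for i
    using fin S0 assms v_eq w_pos by (intro pmf_mnl_choice) auto
  show supp: "set_pmf (mnl_choice v S) \<subseteq> insert 0 S"
    by (auto simp: set_pmf_eq pmf choice_prob_def)
  have "measure_pmf.expectation (mnl_choice v S) f = (\<Sum>i\<in>insert 0 S. f i * pmf (mnl_choice v S) i)"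
    using supp fin by (intro integral_measure_pmf_real) auto
  also have "\<dots> = ?rhs"
    using fin S0 assms
    by (simp add: pmf choice_prob_none choice_prob_member flip: sum_distrib_right)
  finally show "measure_pmf.expectation (mnl_choice v S) f = ?rhs" .
qed

text \<open>
  Revealing the choice of one customer turns the expectation over \<open>Suc t\<close> independent customers into
  one step of the recursion. An arbitrary initial load vector makes the induction go through.
\<close>

lemma expectation_static_choices:
  assumes S: "S \<subseteq> {1..n}"
  shows "measure_pmf.expectation (static_choices v t S)
      (\<lambda>c. real (Max ((\<lambda>i. l i + load t c i) ` S))) = static_value S (rate (card S)) t l"
proof (induction t arbitrary: l)
  case 0
  then show ?case by (simp add: static_choices_def load_def)
next
  case (Suc t)
  have fin: "finite S" and S0: "0 \<notin> S" using assms finite_subset by auto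
  have fin_mnl: "finite (set_pmf (mnl_choice v S))"
    using expectation_mnl_choice(2)[OF S] fin finite_subset by blast
  have fin_static: "finite (set_pmf (static_choices v t S))"
    unfolding static_choices_def using fin_mnl
    by (auto simp: set_Pi_pmf intro!: finite_PiE_dflt)
  have bind: "static_choices v (Suc t) S =
      bind_pmf (mnl_choice v S) (\<lambda>y. map_pmf (\<lambda>c. c(t := y)) (static_choices v t S))"
    unfolding static_choices_def lessThan_Suc
    by (subst Pi_pmf_insert') (auto simp: map_pmf_def)
  have Max_eq: "(\<lambda>i. l i + load (Suc t) (c(t := y)) i) ` S
      = (\<lambda>i. (if y = 0 then l else inc y l) i + load t c i) ` S" for c y
    using S0 by (intro image_cong) (auto simp: load_Suc intro!: gr0I)
  have "measure_pmf.expectation (static_choices v (Suc t) S)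
      (\<lambda>c. real (Max ((\<lambda>i. l i + load (Suc t) c i) ` S))) =
    measure_pmf.expectation (mnl_choice v S) (\<lambda>y. measure_pmf.expectation (static_choices v t S)
      (\<lambda>c. real (Max ((\<lambda>i. l i + load (Suc t) (c(t := y)) i) ` S))))"
    unfolding bind using fin_mnl fin_static by (subst pmf_expectation_bind) (auto simp: integral_measure_pmf)
  also have "\<dots> = measure_pmf.expectation (mnl_choice v S)
      (\<lambda>y. static_value S (rate (card S)) t (if y = 0 then l else inc y l))"
    by (simp only: Max_eq Suc.IH)
  also have "\<dots> = static_value S (rate (card S)) (Suc t) l"
  proof -
    have "(\<Sum>i\<in>S. static_value S (rate (card S)) t (if i = 0 then l else inc i l)) =
      (\<Sum>i\<in>S. static_value S (rate (card S)) t (inc i l))"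
      using S0 by (intro sum.cong) auto
    then show ?thesis by (simp add: expectation_mnl_choice(1)[OF S])
  qed
  finally show ?case .
qed

lemma expected_max_load_eq:
  assumes "S \<subseteq> {1..n}"
  shows "expected_max_load v t S = static_value S (rate (card S)) t (\<lambda>_. 0)"
  using expectation_static_choices[OF assms, of t "\<lambda>_. 0"]
  by (simp add: expected_max_load_def max_load_def)

lemma half_OPT_DP_le_OPT_WO: "1 / 2 * OPT_DP v t n \<le> OPT_WO v t n"
proof -
  \<comment> \<open>\<open>1 / rate 1 = 1 / w + 1\<close>, so \<open>\<lceil>1 / w\<rceil> + 1\<close> products can absorb a total mass of one.\<close>
  define k where "k = min n (nat \<lceil>1 / w\<rceil> + 1)"
  have k1: "1 \<le> k" "k \<le> n" using n_pos by (auto simp: k_def)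
  have k2: "k = n \<or> 1 \<le> k * rate 1"
  proof (cases "k = n")
    case False
    then have "1 / w + 1 \<le> k" using w_pos by (simp add: k_def min_def split: if_splits)
    then have "1 + w \<le> k * w" using w_pos by (simp add: field_simps)
    then show ?thesis using w_pos by (simp add: rate_def)
  qed simp
  have k3: "rate 1 \<le> 2 * rate k"
  proof -
    have "0 < 1 / w" using w_pos by simp
    then have "real (nat \<lceil>1 / w\<rceil>) \<le> 1 / w + 1" by linarith
    moreover have "k \<le> nat \<lceil>1 / w\<rceil> + 1" by (simp add: k_def)
    ultimately have "real k \<le> 1 / w + 2" by linarith
    then have "k * w \<le> (1 / w + 2) * w" using w_pos by (intro mult_right_mono) auto
    also have "\<dots> = 1 + 2 * w" using w_pos by (simp add: field_simps)
    finally have "1 + k * w \<le> 2 * (1 + w)" by simp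
    then have "w / (2 * (1 + w)) \<le> w / (1 + k * w)"
      using w_pos one_plus_pos[of k] by (intro divide_left_mono) auto
    moreover have "rate 1 = 2 * (w / (2 * (1 + w)))"
      using w_pos by (simp add: rate_def field_simps)
    ultimately show ?thesis by (simp add: rate_def)
  qed
  have "count_list [] = (\<lambda>_ :: nat. 0)" by auto
  then have "OPT_DP v t n = dp_value v n t (count_list [])"
    by (simp only: OPT_DP_def)
  also have "\<dots> \<le> 2 * expected_max_load v t {1..k}"
    using dp_value_le_thin[OF k1 k2 k3, of "[]" t] k1 by (simp add: expected_max_load_eq)
  also have "expected_max_load v t {1..k} \<le> OPT_WO v t n"
    unfolding OPT_WO_def using k1 by (intro Max_ge) auto
  finally show ?thesis by simp
qed

end

theorem theorem4p2:
  fixes n T :: nat and v :: "nat \<Rightarrow> real" and w :: real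
  assumes "n \<ge> 1" and "T \<ge> 1" and "w > 0"
    and "\<And>i. i \<in> {1..n} \<Longrightarrow> v i = w"
  shows "OPT_WO v T n \<ge> 1 / 2 * OPT_DP v T n"
proof -
  interpret equal_weights n v w
    using assms by unfold_locales auto
  show ?thesis by (rule half_OPT_DP_le_OPT_WO)
qed

end
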